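(* A set $M\subseteq\omega$ is weakly semirecursive if and only if $M$ is an initial segment of some recursively enumerable quasi-ordering on $\omega$.
   Context: $M\subseteq\omega$ is weakly semirecursive if there is a partial recursive function $\psi$ of two variables such that for all $x,y\in\omega$: if exactly one of $x,y$ belongs to $M$, then $\psi(x,y)$ is defined and $\psi(x,y)\in\{x,y\}\cap M$. A quasi-ordering $\preceq$ on $\omega$ is recursively enumerable if the set of pairs $(x,y)$ with $x\preceq y$ is r.e. For a quasi-ordering $\preceq$ on $\omega$, $M\subseteq\omega$ is an initial segment of $\preceq$ if every element of $M$ is strictly smaller (i.e. $x\preceq y$ and not $y\preceq x$) than every element of the complement $\omega\setminus M$. *)

theory Defs
  imports Main
begin

(* Terms for the partial recursive functions.  The number of arguments is not recorded in the
   term: a term is read at whatever arity it is applied to.  Fixing the arity k of a term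
   determines the arity at which each of its subterms is used, and a subterm used at an arity it
   does not fit is simply undefined there.  So the functions induced on k-tuples are exactly the
   usual partial recursive functions of k variables. *)
datatype recf =
    Zero
  | Succ
  | Proj nat
  | Comp recf "recf list"
  | PrimRec recf recf
  | Mu recf

primrec recf_apply :: "recf \<Rightarrow> nat list \<Rightarrow> nat option" where
  "recf_apply Zero = (\<lambda>xs. Some 0)"
| "recf_apply Succ = (\<lambda>xs. case xs of [x] \<Rightarrow> Some (Suc x) | _ \<Rightarrow> None)"
| "recf_apply (Proj i) = (\<lambda>xs. if i < length xs then Some (xs ! i) else None)"
| "recf_apply (Comp f gs) = (\<lambda>xs.
     let ys = map (\<lambda>h. h xs) (map recf_apply gs)
     in if None \<in> set ys then None else recf_apply f (map the ys))"
| "recf_apply (PrimRec f g) = (\<lambda>xs. case xs of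
       [] \<Rightarrow> None
     | n # ps \<Rightarrow> rec_nat (recf_apply f ps)
                  (\<lambda>m r. Option.bind r (\<lambda>v. recf_apply g (m # v # ps))) n)"
  (* Unbounded search is defined only if all values before the first zero are defined. *)
| "recf_apply (Mu f) = (\<lambda>xs.
     if \<exists>n. recf_apply f (n # xs) = Some 0 \<and> (\<forall>m<n. recf_apply f (m # xs) \<noteq> None)
     then Some (LEAST n. recf_apply f (n # xs) = Some 0)
     else None)"

definition partial_recursive2 :: "(nat \<Rightarrow> nat \<Rightarrow> nat option) \<Rightarrow> bool" where
  "partial_recursive2 \<psi> \<longleftrightarrow> (\<exists>f. \<forall>x y. \<psi> x y = recf_apply f [x, y])"

(* A set of pairs is r.e. if it is the domain of a partial recursive function of two variables. *)
definition re_rel :: "nat rel \<Rightarrow> bool" where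
  "re_rel r \<longleftrightarrow> (\<exists>\<psi>. partial_recursive2 \<psi> \<and> r = {(x, y). \<psi> x y \<noteq> None})"

definition weakly_semirecursive :: "nat set \<Rightarrow> bool" where
  "weakly_semirecursive M \<longleftrightarrow>
     (\<exists>\<psi>. partial_recursive2 \<psi> \<and>
        (\<forall>x y. (x \<in> M) \<noteq> (y \<in> M) \<longrightarrow> (\<exists>z. \<psi> x y = Some z \<and> z \<in> {x, y} \<inter> M)))"

(* The pair (x, y) \<in> r stands for x \<preceq> y. *)
definition initial_segment :: "nat set \<Rightarrow> nat rel \<Rightarrow> bool" where
  "initial_segment M r \<longleftrightarrow> (\<forall>x\<in>M. \<forall>y\<in>-M. (x, y) \<in> r \<and> (y, x) \<notin> r)"

end

theory Submission
  imports Defs "HOL.Filter"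
begin

text \<open>
  Every partial recursive function is the limit of a total recursive function \<open>F\<close> of one more
  argument, a stage number: \<open>F (s # xs) = Suc v\<close> means that value \<open>v\<close> has been reached by stage
  \<open>s\<close>, and \<open>0\<close> that no value has been reached. This replaces a universal machine with a step
  counter and allows parallel searches.

  If \<open>M\<close> is an initial segment of an r.e. quasi-ordering, a selector for \<open>M\<close> waits until one of
  \<open>x \<preceq> y\<close> and \<open>y \<preceq> x\<close> is enumerated and returns the element that is found to be the lower one.
  Conversely, given a selector \<open>\<psi>\<close>, let \<open>\<preceq>\<close> be the reflexive transitive closure of the relation
  \<open>\<psi> x y = x\<close>. It relates each element of \<open>M\<close> to each element of the complement, and no step of
  it enters \<open>M\<close> from outside, since the selector would have chosen the element of \<open>M\<close>. It is r.e.
  because a path is coded by the digits of a number.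
\<close>

section \<open>Total recursive functions and decidable predicates\<close>

definition total_recursive :: "nat \<Rightarrow> (nat list \<Rightarrow> nat) \<Rightarrow> bool" where
  "total_recursive k F \<longleftrightarrow> (\<exists>f. \<forall>xs. length xs = k \<longrightarrow> recf_apply f xs = Some (F xs))"

text \<open>Substitution needs argument tuples. Rules for \<open>[]\<close>, \<open>Cons\<close>,
  \<open>drop\<close> and \<open>map\<close> build them along the syntactic shape of
  \<open>H\<close>, so that closure proofs reduce to applying introduction rules.\<close>

definition total_recursive_list :: "nat \<Rightarrow> nat \<Rightarrow> (nat list \<Rightarrow> nat list) \<Rightarrow> bool" where
  "total_recursive_list k m H \<longleftrightarrow>
     (\<exists>fs. length fs = m \<and> (\<forall>xs. length xs = k \<longrightarrow> map (\<lambda>f. recf_apply f xs) fs = map Some (H xs)))"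

definition decidable :: "nat \<Rightarrow> (nat list \<Rightarrow> bool) \<Rightarrow> bool" where
  "decidable k P \<longleftrightarrow> total_recursive k (\<lambda>xs. of_bool (P xs))"

lemma total_recursive_cong:
  assumes "total_recursive k F" and "\<And>xs. length xs = k \<Longrightarrow> F xs = G xs"
  shows "total_recursive k G"
  using assms unfolding total_recursive_def by metis

lemma recf_apply_Comp:
  assumes "map (\<lambda>g. recf_apply g xs) gs = map Some ys"
  shows "recf_apply (Comp f gs) xs = recf_apply f ys"
proof -
  have "map (\<lambda>h. h xs) (map recf_apply gs) = map Some ys"
    using assms by (simp add: comp_def)
  then show ?thesis
    unfolding recf_apply.simps Let_def
    by (simp add: comp_def del: map_map) (auto simp: comp_def)
qed

lemma recf_apply_PrimRec:
  assumes "recf_apply f ps = Some a"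
    and "\<And>m r. recf_apply g (m # r # ps) = Some (B m r)"
  shows "recf_apply (PrimRec f g) (n # ps) = Some (rec_nat a B n)"
  by (induction n) (use assms in auto)

declare recf_apply.simps(4,6) [simp del]

lemma total_recursive_list_Nil: "total_recursive_list k 0 (\<lambda>xs. [])"
  unfolding total_recursive_list_def by simp

lemma total_recursive_list_Cons:
  assumes "total_recursive k F" and "total_recursive_list k m H"
  shows "total_recursive_list k (Suc m) (\<lambda>xs. F xs # H xs)"
proof -
  obtain f where f: "\<And>xs. length xs = k \<Longrightarrow> recf_apply f xs = Some (F xs)"
    using assms(1) unfolding total_recursive_def by blast
  obtain fs where fs: "length fs = m"
    "\<And>xs. length xs = k \<Longrightarrow> map (\<lambda>f. recf_apply f xs) fs = map Some (H xs)"
    using assms(2) unfolding total_recursive_list_def by blast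
  show ?thesis
    unfolding total_recursive_list_def by (rule exI[of _ "f # fs"]) (simp add: f fs)
qed

text \<open>The parameters of a recursion or search follow its own variables in the argument list;
  the projections \<open>Proj j\<close>, ..., \<open>Proj (k - 1)\<close> hand them on
  unchanged.\<close>

lemma total_recursive_list_drop:
  assumes "k = j + m"
  shows "total_recursive_list k m (drop j)"
  unfolding total_recursive_list_def
proof (intro exI conjI allI impI)
  fix xs :: "nat list"
  assume "length xs = k"
  then show "map (\<lambda>f. recf_apply f xs) (map Proj [j..<k]) = map Some (drop j xs)"
    by (auto intro!: nth_equalityI)
qed (use assms in simp)

lemma total_recursive_list_map:
  assumes "\<And>g. g \<in> set gs \<Longrightarrow> total_recursive k (F g)"
  shows "total_recursive_list k (length gs) (\<lambda>xs. map (\<lambda>g. F g xs) gs)"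
  using assms
  by (induction gs) (auto intro: total_recursive_list_Nil total_recursive_list_Cons)

lemma total_recursive_comp:
  assumes "total_recursive m F" and "total_recursive_list k m H"
  shows "total_recursive k (\<lambda>xs. F (H xs))"
proof -
  obtain f where f: "\<And>xs. length xs = m \<Longrightarrow> recf_apply f xs = Some (F xs)"
    using assms(1) unfolding total_recursive_def by blast
  obtain fs where fs: "length fs = m"
    "\<And>xs. length xs = k \<Longrightarrow> map (\<lambda>f. recf_apply f xs) fs = map Some (H xs)"
    using assms(2) unfolding total_recursive_list_def by blast
  have "recf_apply (Comp f fs) xs = Some (F (H xs))" if "length xs = k" for xs
    using recf_apply_Comp[OF fs(2)[OF that]] f[of "H xs"] fs(1) arg_cong[OF fs(2)[OF that], of length]
    by simp
  then show ?thesis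
    unfolding total_recursive_def by blast
qed

lemma total_recursive_nth: "i < k \<Longrightarrow> total_recursive k (\<lambda>xs. xs ! i)"
  unfolding total_recursive_def by (rule exI[of _ "Proj i"]) simp

lemma total_recursive_nth_drop: "j + i < k \<Longrightarrow> total_recursive k (\<lambda>xs. drop j xs ! i)"
  by (rule total_recursive_cong[OF total_recursive_nth[of "j + i"]]) auto

lemma total_recursive_Suc:
  assumes "total_recursive k F"
  shows "total_recursive k (\<lambda>xs. Suc (F xs))"
proof -
  have "total_recursive 1 (\<lambda>ys. Suc (ys ! 0))"
    unfolding total_recursive_def
    by (rule exI[of _ Succ]) (auto simp: length_Suc_conv)
  from total_recursive_comp[OF this, of k "\<lambda>xs. [F xs]"] show ?thesis
    using total_recursive_list_Cons[OF assms total_recursive_list_Nil] by simp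
qed

lemma total_recursive_const: "total_recursive k (\<lambda>xs. c)"
proof (induction c)
  case 0
  show ?case
    unfolding total_recursive_def by (rule exI[of _ Zero]) simp
qed (rule total_recursive_Suc)

text \<open>The list \<open>ys\<close> holds the counter, the previous value and the parameters, in
  that order. \<open>PrimRec\<close> recurses on its first argument; substituting
  \<open>N xs\<close> for it gives recursion up to a computed bound.\<close>

lemma total_recursive_rec_nat:
  assumes "total_recursive k A" "total_recursive k N"
    and "total_recursive (Suc (Suc k)) (\<lambda>ys. B (ys ! 0) (ys ! 1) (drop 2 ys))"
  shows "total_recursive k (\<lambda>xs. rec_nat (A xs) (\<lambda>m r. B m r xs) (N xs))"
proof -
  obtain a where a: "\<And>xs. length xs = k \<Longrightarrow> recf_apply a xs = Some (A xs)"
    using assms(1) unfolding total_recursive_def by blast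
  obtain b where b: "\<And>ys. length ys = Suc (Suc k) \<Longrightarrow>
      recf_apply b ys = Some (B (ys ! 0) (ys ! 1) (drop 2 ys))"
    using assms(3) unfolding total_recursive_def by blast
  have "recf_apply (PrimRec a b) (n # xs) = Some (rec_nat (A xs) (\<lambda>m r. B m r xs) n)"
    if "length xs = k" for n xs
    using that by (intro recf_apply_PrimRec) (simp_all add: a b)
  then have "total_recursive (Suc k)
      (\<lambda>ys. rec_nat (A (drop 1 ys)) (\<lambda>m r. B m r (drop 1 ys)) (ys ! 0))"
    unfolding total_recursive_def length_Suc_conv
    by (intro exI[of _ "PrimRec a b"]) (auto)
  \<comment> \<open>\<open>drop 0 xs\<close> is \<open>xs\<close>, written so that the rule for
    \<open>drop\<close> supplies it as an argument tuple.\<close>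
  from total_recursive_comp[OF this, of k "\<lambda>xs. N xs # drop 0 xs"] show ?thesis
    using total_recursive_list_Cons[OF assms(2) total_recursive_list_drop[of k 0 k]] by simp
qed

text \<open>A case distinction is a recursion whose step forgets both the counter and the previous
  value: it gives \<open>A\<close> at 0 and \<open>B\<close> at every successor.\<close>

lemma total_recursive_if_zero:
  assumes "total_recursive k N" "total_recursive k A" "total_recursive k B"
  shows "total_recursive k (\<lambda>xs. if N xs = 0 then A xs else B xs)"
proof -
  have "total_recursive (Suc (Suc k)) (\<lambda>ys. B (drop 2 ys))"
    by (rule total_recursive_comp[OF assms(3)]) (simp add: total_recursive_list_drop)
  from total_recursive_rec_nat[OF assms(2,1), of "\<lambda>_ _. B", OF this] show ?thesis
    by (rule total_recursive_cong) (auto split: nat.split simp: gr0_conv_Suc)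
qed

lemma total_recursive_if:
  assumes "decidable k P" "total_recursive k A" "total_recursive k B"
  shows "total_recursive k (\<lambda>xs. if P xs then A xs else B xs)"
  using total_recursive_if_zero[OF assms(1)[unfolded decidable_def] assms(3,2)]
  by (rule total_recursive_cong) auto

text \<open>The step of the recursion returns the counter, so recursion up to \<open>Suc m\<close>
  ends with \<open>m\<close>.\<close>

lemma total_recursive_pred:
  assumes "total_recursive k F"
  shows "total_recursive k (\<lambda>xs. F xs - 1)"
proof -
  have "total_recursive k (\<lambda>xs. rec_nat 0 (\<lambda>m r. m) (F xs))"
    by (intro total_recursive_rec_nat total_recursive_const total_recursive_nth assms) simp
  then show ?thesis
    by (rule total_recursive_cong) (auto split: nat_diff_split simp: gr0_conv_Suc)
qed

lemma total_recursive_add: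
  assumes "total_recursive k F" "total_recursive k G"
  shows "total_recursive k (\<lambda>xs. F xs + G xs)"
proof -
  have eq: "rec_nat m (\<lambda>_. Suc) n = m + n" for m n
    by (induction n) auto
  have "total_recursive k (\<lambda>xs. rec_nat (F xs) (\<lambda>m r. Suc r) (G xs))"
    by (intro total_recursive_rec_nat total_recursive_Suc total_recursive_nth assms) simp
  then show ?thesis
    by (simp add: eq)
qed

lemma total_recursive_diff:
  assumes "total_recursive k F" "total_recursive k G"
  shows "total_recursive k (\<lambda>xs. F xs - G xs)"
proof -
  have eq: "rec_nat m (\<lambda>_ r. r - 1) n = m - n" for m n :: nat
    by (induction n) auto
  have "total_recursive k (\<lambda>xs. rec_nat (F xs) (\<lambda>m r. r - 1) (G xs))"
    by (intro total_recursive_rec_nat total_recursive_pred total_recursive_nth assms) simp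
  then show ?thesis
    by (simp only: eq)
qed

lemma total_recursive_mult:
  assumes "total_recursive k F" "total_recursive k G"
  shows "total_recursive k (\<lambda>xs. F xs * G xs)"
proof -
  have eq: "rec_nat 0 (\<lambda>_ r. r + m) n = m * n" for m n :: nat
    by (induction n) auto
  have "total_recursive k (\<lambda>xs. rec_nat 0 (\<lambda>m r. r + F xs) (G xs))"
    by (intro total_recursive_rec_nat total_recursive_const total_recursive_add total_recursive_nth
        total_recursive_comp[OF assms(1)] total_recursive_list_drop assms) simp_all
  then show ?thesis
    by (simp only: eq)
qed

lemma total_recursive_power:
  assumes "total_recursive k F" "total_recursive k G"
  shows "total_recursive k (\<lambda>xs. F xs ^ G xs)"
proof -
  have eq: "rec_nat 1 (\<lambda>_ r. r * m) n = m ^ n" for m n :: nat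
    by (induction n) auto
  have "total_recursive k (\<lambda>xs. rec_nat 1 (\<lambda>m r. r * F xs) (G xs))"
    by (intro total_recursive_rec_nat total_recursive_const total_recursive_mult total_recursive_nth
        total_recursive_comp[OF assms(1)] total_recursive_list_drop assms) simp_all
  then show ?thesis
    by (simp only: eq)
qed

lemma decidable_not: "decidable k P \<Longrightarrow> decidable k (\<lambda>xs. \<not> P xs)"
  unfolding decidable_def
  using total_recursive_diff[OF total_recursive_const[of k 1]]
  by (rule total_recursive_cong) auto

lemma decidable_conj:
  "decidable k P \<Longrightarrow> decidable k Q \<Longrightarrow> decidable k (\<lambda>xs. P xs \<and> Q xs)"
  unfolding decidable_def of_bool_conj
  by (rule total_recursive_mult)

lemma decidable_disj:
  "decidable k P \<Longrightarrow> decidable k Q \<Longrightarrow> decidable k (\<lambda>xs. P xs \<or> Q xs)"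
  using decidable_not[OF decidable_conj[OF decidable_not decidable_not]] by simp

lemma decidable_le:
  assumes "total_recursive k F" "total_recursive k G"
  shows "decidable k (\<lambda>xs. F xs \<le> G xs)"
  unfolding decidable_def
  by (rule total_recursive_cong[OF total_recursive_if_zero[OF total_recursive_diff[OF assms]
        total_recursive_const[of k 1] total_recursive_const[of k 0]]]) auto

lemma decidable_eq:
  assumes "total_recursive k F" "total_recursive k G"
  shows "decidable k (\<lambda>xs. F xs = G xs)"
  using decidable_conj[OF decidable_le[OF assms] decidable_le[OF assms(2,1)]]
  by (simp add: order_eq_iff)

lemma decidable_comp:
  assumes "decidable m P" and "total_recursive_list k m H"
  shows "decidable k (\<lambda>xs. P (H xs))"
  using total_recursive_comp[OF assms(1)[unfolded decidable_def] assms(2)]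
  unfolding decidable_def .

text \<open>The recursion overwrites its result at every hit, so it returns \<open>Suc i\<close> for
  the largest \<open>i\<close> below the bound that satisfies \<open>P\<close>, and 0 if there is no
  such \<open>i\<close>.\<close>

lemma total_recursive_bounded_search:
  assumes "total_recursive k N" and "decidable (Suc k) (\<lambda>ys. P (ys ! 0) (drop 1 ys))"
  shows "total_recursive k (\<lambda>xs. rec_nat 0 (\<lambda>i r. if P i xs then Suc i else r) (N xs))"
proof -
  \<comment> \<open>The test sees the counter and the parameters, but not the previous value at
    position 1.\<close>
  have "total_recursive_list (Suc (Suc k)) (Suc k) (\<lambda>ys. ys ! 0 # drop 2 ys)"
    by (intro total_recursive_list_Cons total_recursive_nth total_recursive_list_drop) simp_all
  from decidable_comp[OF assms(2) this]
  have "decidable (Suc (Suc k)) (\<lambda>ys. P (ys ! 0) (drop 2 ys))"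
    by simp
  then show ?thesis
    by (intro total_recursive_rec_nat total_recursive_if total_recursive_Suc total_recursive_const
        total_recursive_nth assms(1)) simp_all
qed

lemma bounded_search_sound:
  assumes "rec_nat 0 (\<lambda>i r. if P i then Suc i else r) n = Suc v"
  shows "v < n \<and> P v"
  using assms by (induction n) (auto split: if_splits simp: less_Suc_eq)

lemma bounded_search_eq_0_iff:
  "rec_nat (0::nat) (\<lambda>i r. if P i then Suc i else r) n = 0 \<longleftrightarrow> (\<forall>i<n. \<not> P i)"
  by (induction n) (auto simp: less_Suc_eq)

lemma decidable_Ex_less:
  assumes "total_recursive k N" and "decidable (Suc k) (\<lambda>ys. P (ys ! 0) (drop 1 ys))"
  shows "decidable k (\<lambda>xs. \<exists>i<N xs. P i xs)"
  using decidable_not[OF decidable_eq[OF total_recursive_bounded_search[OF assms]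
    total_recursive_const[of k 0]]]
  by (simp add: bounded_search_eq_0_iff)

lemma decidable_All_less:
  assumes "total_recursive k N" and "decidable (Suc k) (\<lambda>ys. P (ys ! 0) (drop 1 ys))"
  shows "decidable k (\<lambda>xs. \<forall>i<N xs. P i xs)"
  using decidable_not[OF decidable_Ex_less[OF assms(1), of "\<lambda>i xs. \<not> P i xs",
    OF decidable_not[OF assms(2)]]]
  by simp

lemma total_recursive_div:
  assumes "total_recursive k F" "total_recursive k G"
  shows "total_recursive k (\<lambda>xs. F xs div G xs)"
proof -
  \<comment> \<open>The hits are the \<open>i\<close> with \<open>Suc i \<le> c div q\<close>, so
    the last one below \<open>n\<close> gives the minimum. The bound \<open>n = c\<close> then
    yields the quotient, because \<open>c div q \<le> c\<close>. Division by 0 is treated apart,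
    with value 0.\<close>
  have eq: "rec_nat 0 (\<lambda>i r. if Suc i * q \<le> c then Suc i else r) n = min n (c div q)"
    if "q > 0" for q c n :: nat
    using that
    by (induction n)
      (auto simp: less_eq_div_iff_mult_less_eq[symmetric] min_def simp del: mult_Suc)
  have "total_recursive k (\<lambda>xs. if G xs = 0 then 0
      else rec_nat 0 (\<lambda>i r. if Suc i * G xs \<le> F xs then Suc i else r) (F xs))"
    by (intro total_recursive_if_zero total_recursive_bounded_search total_recursive_const
        decidable_le total_recursive_mult total_recursive_Suc total_recursive_nth
        total_recursive_comp[OF assms(1)] total_recursive_comp[OF assms(2)]
        total_recursive_list_drop assms) simp_all
  then show ?thesis
    by (rule total_recursive_cong) (auto simp: eq simp del: mult_Suc)
qed

lemma total_recursive_mod: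
  assumes "total_recursive k F" "total_recursive k G"
  shows "total_recursive k (\<lambda>xs. F xs mod G xs)"
  using total_recursive_diff[OF assms(1)
    total_recursive_mult[OF total_recursive_div[OF assms] assms(2)]]
  by (simp add: minus_div_mult_eq_mod)

lemma decidable_Bex_list:
  assumes "\<And>g. g \<in> set gs \<Longrightarrow> decidable k (P g)"
  shows "decidable k (\<lambda>xs. \<exists>g\<in>set gs. P g xs)"
  using assms
proof (induction gs)
  case Nil
  show ?case
    by (simp add: decidable_def total_recursive_const)
next
  case (Cons g gs)
  then show ?case
    using decidable_disj[of k "P g" "\<lambda>xs. \<exists>g\<in>set gs. P g xs"] by simp
qed

section \<open>Stage functions of partial recursive functions\<close>

text \<open>
  Monotonicity in the stage is not demanded: stages that find no value are harmless if they are
  only finitely many.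
\<close>

definition stage_function :: "nat \<Rightarrow> (nat list \<Rightarrow> nat) \<Rightarrow> (nat list \<Rightarrow> nat option) \<Rightarrow> bool" where
  "stage_function k F \<phi> \<longleftrightarrow> total_recursive (Suc k) F \<and> (\<forall>xs v. length xs = k \<longrightarrow>
     (\<forall>s. F (s # xs) = Suc v \<longrightarrow> \<phi> xs = Some v) \<and>
     (\<phi> xs = Some v \<longrightarrow> (\<forall>\<^sub>F s in sequentially. F (s # xs) = Suc v)))"

lemma stage_functionI:
  assumes "total_recursive (Suc k) F"
    and "\<And>xs v s. length xs = k \<Longrightarrow> F (s # xs) = Suc v \<Longrightarrow> \<phi> xs = Some v"
    and "\<And>xs v. length xs = k \<Longrightarrow> \<phi> xs = Some v \<Longrightarrow> \<forall>\<^sub>F s in sequentially. F (s # xs) = Suc v"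
  shows "stage_function k F \<phi>"
  using assms unfolding stage_function_def by blast

lemma stage_functionD:
  assumes "stage_function k F \<phi>"
  shows "total_recursive (Suc k) F"
    and "length xs = k \<Longrightarrow> F (s # xs) = Suc v \<Longrightarrow> \<phi> xs = Some v"
    and "length xs = k \<Longrightarrow> \<phi> xs = Some v \<Longrightarrow> \<forall>\<^sub>F s in sequentially. F (s # xs) = Suc v"
  using assms unfolding stage_function_def by blast+

lemma stage_function_total:
  assumes "total_recursive k G" and "\<And>xs. length xs = k \<Longrightarrow> \<phi> xs = Some (G xs)"
  shows "stage_function k (\<lambda>ys. Suc (G (drop 1 ys))) \<phi>"
  by (rule stage_functionI)
    (auto intro!: total_recursive_Suc total_recursive_comp[OF assms(1)] total_recursive_list_drop
      simp: assms(2))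

lemma stage_function_undefined:
  assumes "\<And>xs. length xs = k \<Longrightarrow> \<phi> xs = None"
  shows "stage_function k (\<lambda>ys. 0) \<phi>"
  by (rule stage_functionI) (auto intro: total_recursive_const simp: assms)

text \<open>All inner functions are evaluated at the same stage. A missing inner value makes the
  result 0; otherwise subtracting 1 decodes the values before they are passed to
  \<open>F\<close>.\<close>

lemma stage_function_Comp:
  assumes f: "stage_function (length gs) F (recf_apply f)"
    and g: "\<And>g. g \<in> set gs \<Longrightarrow> stage_function k (G g) (recf_apply g)"
  shows "stage_function k
     (\<lambda>ys. if \<exists>g\<in>set gs. G g ys = 0 then 0 else F (ys ! 0 # map (\<lambda>g. G g ys - 1) gs))
     (recf_apply (Comp f gs))"
proof (rule stage_functionI)
  show "total_recursive (Suc k)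
     (\<lambda>ys. if \<exists>g\<in>set gs. G g ys = 0 then 0 else F (ys ! 0 # map (\<lambda>g. G g ys - 1) gs))"
    by (intro total_recursive_if decidable_Bex_list decidable_eq total_recursive_const
        total_recursive_comp[OF stage_functionD(1)[OF f]] total_recursive_list_Cons
        total_recursive_list_map total_recursive_pred total_recursive_nth
        stage_functionD(1)[OF g]) simp_all
next
  fix xs v s
  assume len: "length xs = k"
    and "(if \<exists>g\<in>set gs. G g (s # xs) = 0 then 0
      else F ((s # xs) ! 0 # map (\<lambda>g. G g (s # xs) - 1) gs)) = Suc v"
  then have nz: "\<And>g. g \<in> set gs \<Longrightarrow> G g (s # xs) \<noteq> 0"
    and F: "F (s # map (\<lambda>g. G g (s # xs) - 1) gs) = Suc v"
    by (auto split: if_splits)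
  have "map (\<lambda>g. recf_apply g xs) gs = map Some (map (\<lambda>g. G g (s # xs) - 1) gs)"
    using stage_functionD(2)[OF g len] nz by fastforce
  from recf_apply_Comp[OF this] show "recf_apply (Comp f gs) xs = Some v"
    using stage_functionD(2)[OF f _ F] by simp
next
  fix xs v
  assume len: "length xs = k" and "recf_apply (Comp f gs) xs = Some v"
  then have "None \<notin> set (map (\<lambda>g. recf_apply g xs) gs)"
    and v: "recf_apply f (map (\<lambda>g. the (recf_apply g xs)) gs) = Some v"
    by (simp_all add: recf_apply.simps(4) Let_def comp_def image_image split: if_splits)
  then have def: "recf_apply g xs \<noteq> None" if "g \<in> set gs" for g
    using that by (metis (no_types, lifting) image_eqI set_map)
  \<comment> \<open>There are finitely many inner functions, so from some stage on all of them show
    their values simultaneously.\<close>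
  have "\<forall>\<^sub>F s in sequentially. \<forall>g\<in>set gs. G g (s # xs) = Suc (the (recf_apply g xs))"
    using def stage_functionD(3)[OF g len] by (intro eventually_ball_finite) auto
  moreover have "\<forall>\<^sub>F s in sequentially. F (s # map (\<lambda>g. the (recf_apply g xs)) gs) = Suc v"
    using stage_functionD(3)[OF f _ v] by simp
  ultimately show "\<forall>\<^sub>F s in sequentially. (if \<exists>g\<in>set gs. G g (s # xs) = 0 then 0
      else F ((s # xs) ! 0 # map (\<lambda>g. G g (s # xs) - 1) gs)) = Suc v"
  proof eventually_elim
    case (elim s)
    then have "map (\<lambda>g. G g (s # xs) - 1) gs = map (\<lambda>g. the (recf_apply g xs)) gs"
      by simp
    with elim(2) have "F (s # map (\<lambda>g. G g (s # xs) - 1) gs) = Suc v"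
      by (simp only:)
    with elim(1) show ?case
      by simp
  qed
qed

text \<open>In \<open>ys\<close>, position 0 is the stage, position 1 the recursion argument, and
  \<open>drop 2 ys\<close> the parameters. A 0 arising on the way is propagated, which mirrors
  undefinedness; a nonzero \<open>r\<close> codes the previous value \<open>r - 1\<close>.\<close>

lemma stage_function_PrimRec:
  assumes f: "stage_function k F (recf_apply f)"
    and g: "stage_function (Suc (Suc k)) G (recf_apply g)"
  shows "stage_function (Suc k)
     (\<lambda>ys. rec_nat (F (ys ! 0 # drop 2 ys))
        (\<lambda>m r. if r = 0 then 0 else G (ys ! 0 # m # (r - 1) # drop 2 ys)) (ys ! 1))
     (recf_apply (PrimRec f g))"
proof (rule stage_functionI)
  show "total_recursive (Suc (Suc k))
     (\<lambda>ys. rec_nat (F (ys ! 0 # drop 2 ys))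
        (\<lambda>m r. if r = 0 then 0 else G (ys ! 0 # m # (r - 1) # drop 2 ys)) (ys ! 1))"
    by (intro total_recursive_rec_nat total_recursive_if_zero total_recursive_const
        total_recursive_comp[OF stage_functionD(1)[OF f]]
        total_recursive_comp[OF stage_functionD(1)[OF g]] total_recursive_list_Cons
        total_recursive_pred total_recursive_nth total_recursive_nth_drop
        total_recursive_list_drop | simp add: total_recursive_list_drop)+
next
  fix xs v s
  let ?R = "\<lambda>ps. rec_nat (F (s # ps)) (\<lambda>m r. if r = 0 then 0 else G (s # m # (r - 1) # ps))"
  have *: "?R ps n = Suc v \<Longrightarrow> recf_apply (PrimRec f g) (n # ps) = Some v"
    if "length ps = k" for ps n v
  proof (induction n arbitrary: v)
    case 0
    then show ?case
      using stage_functionD(2)[OF f that] by simp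
  next
    case (Suc n)
    then obtain w where w: "?R ps n = Suc w"
      by (cases "?R ps n") auto
    with Suc.prems have "recf_apply g (n # w # ps) = Some v"
      using stage_functionD(2)[OF g, of "n # w # ps"] that by simp
    with Suc.IH[OF w] show ?case
      by simp
  qed
  assume "length xs = Suc k"
    and "rec_nat (F ((s # xs) ! 0 # drop 2 (s # xs)))
      (\<lambda>m r. if r = 0 then 0 else G ((s # xs) ! 0 # m # (r - 1) # drop 2 (s # xs)))
      ((s # xs) ! 1) = Suc v"
  moreover obtain n ps where "xs = n # ps" "length ps = k"
    using calculation(1) by (auto simp: length_Suc_conv)
  ultimately show "recf_apply (PrimRec f g) xs = Some v"
    using *[of ps n v] by (simp cong: if_cong)
next
  fix xs v
  let ?R = "\<lambda>s ps. rec_nat (F (s # ps)) (\<lambda>m r. if r = 0 then 0 else G (s # m # (r - 1) # ps))"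
  \<comment> \<open>For fixed \<open>n\<close> only finitely many evaluations of \<open>f\<close>
    and \<open>g\<close> occur; the induction combines the stages from which they are
    settled.\<close>
  have *: "recf_apply (PrimRec f g) (n # ps) = Some v \<Longrightarrow>
      \<forall>\<^sub>F s in sequentially. ?R s ps n = Suc v"
    if "length ps = k" for ps n v
  proof (induction n arbitrary: v)
    case 0
    then show ?case
      using stage_functionD(3)[OF f that] by simp
  next
    case (Suc n)
    then obtain w where w: "recf_apply (PrimRec f g) (n # ps) = Some w"
      and v: "recf_apply g (n # w # ps) = Some v"
      by (auto simp: bind_eq_Some_conv)
    have "\<forall>\<^sub>F s in sequentially. G (s # n # w # ps) = Suc v"
      using stage_functionD(3)[OF g _ v] that by simp
    with Suc.IH[OF w] show ?case
      by eventually_elim simp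
  qed
  assume "length xs = Suc k" and "recf_apply (PrimRec f g) xs = Some v"
  then show "\<forall>\<^sub>F s in sequentially. rec_nat (F ((s # xs) ! 0 # drop 2 (s # xs)))
      (\<lambda>m r. if r = 0 then 0 else G ((s # xs) ! 0 # m # (r - 1) # drop 2 (s # xs)))
      ((s # xs) ! 1) = Suc v"
    using * by (auto simp: length_Suc_conv cong: if_cong)
qed

text \<open>The definition of \<open>Mu\<close> guarantees that all values below some zero
  \<open>n\<close> are defined. The least zero \<open>v\<close> is at most \<open>n\<close>, so the
  values below \<open>v\<close> are defined, and by minimality they are successors.\<close>

lemma recf_apply_Mu_eq_Some_iff:
  "recf_apply (Mu f) xs = Some v \<longleftrightarrow>
     recf_apply f (v # xs) = Some 0 \<and> (\<forall>i<v. \<exists>w. recf_apply f (i # xs) = Some (Suc w))"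
    (is "?L \<longleftrightarrow> ?R")
proof
  assume ?L
  then obtain n where n: "recf_apply f (n # xs) = Some 0" "\<And>m. m < n \<Longrightarrow> recf_apply f (m # xs) \<noteq> None"
    and v: "v = (LEAST n. recf_apply f (n # xs) = Some 0)"
    by (auto simp: recf_apply.simps(6) split: if_splits)
  have "recf_apply f (v # xs) = Some 0"
    unfolding v by (rule LeastI, rule n(1))
  moreover have "v \<le> n"
    unfolding v by (rule Least_le, rule n(1))
  moreover have "recf_apply f (i # xs) \<noteq> Some 0" if "i < v" for i
    using not_less_Least that unfolding v by blast
  ultimately show ?R
    using n(2) by (metis less_le_trans not0_implies_Suc option.exhaust)
next
  assume R: ?R
  then have "(LEAST n. recf_apply f (n # xs) = Some 0) = v"
    by (intro Least_equality) (auto simp: not_less[symmetric])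
  with R show ?L
    by (fastforce simp: recf_apply.simps(6))
qed

text \<open>In \<open>F\<close>, value 0 is coded by 1 and a positive value by a number that is at
  least 2. The stage does double duty: it is passed to \<open>F\<close> and it bounds the
  search.\<close>

lemma stage_function_Mu:
  assumes f: "stage_function (Suc k) F (recf_apply f)"
  shows "stage_function k
     (\<lambda>ys. rec_nat 0 (\<lambda>n r. if F (ys ! 0 # n # drop 1 ys) = 1 \<and>
        (\<forall>i<n. 2 \<le> F (ys ! 0 # i # drop 1 ys)) then Suc n else r) (ys ! 0))
     (recf_apply (Mu f))"
proof (rule stage_functionI)
  show "total_recursive (Suc k)
     (\<lambda>ys. rec_nat 0 (\<lambda>n r. if F (ys ! 0 # n # drop 1 ys) = 1 \<and>
        (\<forall>i<n. 2 \<le> F (ys ! 0 # i # drop 1 ys)) then Suc n else r) (ys ! 0))"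
    by (intro total_recursive_bounded_search total_recursive_const decidable_conj decidable_eq
        decidable_All_less decidable_le
        total_recursive_comp[OF stage_functionD(1)[OF f]] total_recursive_list_Cons
        total_recursive_nth total_recursive_nth_drop
        total_recursive_list_drop | simp add: total_recursive_list_drop total_recursive_nth_drop)+
next
  fix xs v s
  let ?P = "\<lambda>n. F (s # n # xs) = 1 \<and> (\<forall>i<n. 2 \<le> F (s # i # xs))"
  assume len: "length xs = k"
    and "rec_nat 0 (\<lambda>n r. if F ((s # xs) ! 0 # n # drop 1 (s # xs)) = 1 \<and>
        (\<forall>i<n. 2 \<le> F ((s # xs) ! 0 # i # drop 1 (s # xs))) then Suc n else r) ((s # xs) ! 0)
        = Suc v"
  then have "?P v"
    using bounded_search_sound[of ?P s v] by simp
  have "\<exists>w. recf_apply f (i # xs) = Some (Suc w)" if "i < v" for i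
  proof -
    have "F (s # i # xs) = Suc (Suc (F (s # i # xs) - 2))"
      using \<open>?P v\<close> that by (metis add_2_eq_Suc le_add_diff_inverse)
    then show ?thesis
      using stage_functionD(2)[OF f] len by (metis length_Cons)
  qed
  then show "recf_apply (Mu f) xs = Some v"
    using \<open>?P v\<close> stage_functionD(2)[OF f, of "v # xs" s 0] len
    unfolding recf_apply_Mu_eq_Some_iff by simp
next
  fix xs v
  let ?P = "\<lambda>s n. F (s # n # xs) = 1 \<and> (\<forall>i<n. 2 \<le> F (s # i # xs))"
  assume len: "length xs = k" and Mu: "recf_apply (Mu f) xs = Some v"
  have "\<forall>\<^sub>F s in sequentially. 2 \<le> F (s # i # xs)" if i: "i < v" for i
  proof -
    obtain w where "recf_apply f (i # xs) = Some (Suc w)"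
      using Mu i unfolding recf_apply_Mu_eq_Some_iff by blast
    then have "\<forall>\<^sub>F s in sequentially. F (s # i # xs) = Suc (Suc w)"
      using stage_functionD(3)[OF f] len by simp
    then show ?thesis
      by eventually_elim simp
  qed
  then have "\<forall>\<^sub>F s in sequentially. \<forall>i\<in>{..<v}. 2 \<le> F (s # i # xs)"
    by (intro eventually_ball_finite) auto
  moreover have "\<forall>\<^sub>F s in sequentially. F (s # v # xs) = Suc 0"
    using stage_functionD(3)[OF f] len Mu unfolding recf_apply_Mu_eq_Some_iff by simp
  \<comment> \<open>The search at stage \<open>s\<close> inspects only numbers below
    \<open>s\<close>.\<close>
  moreover have "\<forall>\<^sub>F s in sequentially. v < s"
    by (rule eventually_gt_at_top)
  ultimately show "\<forall>\<^sub>F s in sequentially.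
      rec_nat 0 (\<lambda>n r. if F ((s # xs) ! 0 # n # drop 1 (s # xs)) = 1 \<and>
        (\<forall>i<n. 2 \<le> F ((s # xs) ! 0 # i # drop 1 (s # xs))) then Suc n else r) ((s # xs) ! 0)
        = Suc v"
  proof eventually_elim
    case (elim s)
    let ?S = "rec_nat 0 (\<lambda>n r. if ?P s n then Suc n else r) s"
    have v: "?P s v"
      using elim by auto
    then have "?S \<noteq> 0"
      using elim bounded_search_eq_0_iff[of "?P s" s] by blast
    then obtain n where n: "?S = Suc n"
      using not0_implies_Suc by blast
    then have "?P s n"
      by (rule bounded_search_sound[of "?P s", THEN conjunct2])
    \<comment> \<open>If two different numbers satisfied \<open>?P s\<close>, then \<open>F\<close>
      would be both 1 and at least 2 at the smaller one. Hence it does no harm that the bounded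
      search returns the largest hit.\<close>
    with v have "n = v"
      by (metis nat_neq_iff numeral_le_one_iff semiring_norm(69))
    with n show ?case
      by simp
  qed
qed

text \<open>Induction over terms, for all arities at once, because subterms may be used at another
  arity than the whole term. At an arity that \<open>Succ\<close>, \<open>Proj\<close> or
  \<open>PrimRec\<close> does not fit, the constant stage function 0 serves.\<close>

lemma ex_stage_function: "\<exists>F. stage_function k F (recf_apply f)"
proof (induction f arbitrary: k)
  case Zero
  show ?case
    by (rule exI, rule stage_function_total[OF total_recursive_const[of _ 0]]) simp
next
  case Succ
  show ?case
  proof (cases "k = 1")
    case True
    show ?thesis
      by (rule exI, rule stage_function_total[OF total_recursive_Suc[OF total_recursive_nth[of 0]]])
        (auto simp: True length_Suc_conv)
  next
    case False
    then show ?thesis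
      by - (rule exI, rule stage_function_undefined, auto split: list.split)
  qed
next
  case (Proj i)
  show ?case
  proof (cases "i < k")
    case True
    then show ?thesis
      by - (rule exI, rule stage_function_total[OF total_recursive_nth[OF True]], simp)
  next
    case False
    then show ?thesis
      by - (rule exI, rule stage_function_undefined, simp)
  qed
next
  case (Comp f gs)
  obtain F where "stage_function (length gs) F (recf_apply f)"
    using Comp.IH(1) by blast
  moreover obtain G where "\<And>g. g \<in> set gs \<Longrightarrow> stage_function k (G g) (recf_apply g)"
    using bchoice[of "set gs" "\<lambda>g F. stage_function k F (recf_apply g)"] Comp.IH(2) by blast
  ultimately show ?case
    using stage_function_Comp by blast
next
  case (PrimRec f g)
  show ?case
  proof (cases k)
    case 0
    then show ?thesis
      by - (rule exI, rule stage_function_undefined, simp)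
  next
    case (Suc j)
    then show ?thesis
      using PrimRec.IH stage_function_PrimRec by blast
  qed
next
  case (Mu f)
  then show ?case
    using stage_function_Mu by blast
qed

lemma partial_recursive2_stage_function:
  assumes "partial_recursive2 \<psi>"
  obtains F where "total_recursive 3 F"
    and "\<And>s x y v. F [s, x, y] = Suc v \<Longrightarrow> \<psi> x y = Some v"
    and "\<And>x y v. \<psi> x y = Some v \<Longrightarrow> \<forall>\<^sub>F s in sequentially. F [s, x, y] = Suc v"
proof -
  obtain f where f: "\<And>x y. \<psi> x y = recf_apply f [x, y]"
    using assms unfolding partial_recursive2_def by blast
  obtain F where F: "stage_function 2 F (recf_apply f)"
    using ex_stage_function by blast
  show thesis
  proof
    show "total_recursive 3 F"
      using stage_functionD(1)[OF F] by (simp add: eval_nat_numeral)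
    show "\<psi> x y = Some v" if "F [s, x, y] = Suc v" for s x y v
      using stage_functionD(2)[OF F, of "[x, y]"] that by (simp add: f)
    show "\<forall>\<^sub>F s in sequentially. F [s, x, y] = Suc v" if "\<psi> x y = Some v" for x y v
      using stage_functionD(3)[OF F, of "[x, y]"] that by (simp add: f)
  qed
qed

section \<open>Unbounded search over decidable predicates\<close>

lemma decidable_search:
  assumes "decidable (Suc k) P"
  obtains f where "\<And>xs v. length xs = k \<Longrightarrow>
    recf_apply (Mu f) xs = Some v \<longleftrightarrow> P (v # xs) \<and> (\<forall>i<v. \<not> P (i # xs))"
proof -
  \<comment> \<open>\<open>Mu\<close> looks for a zero, so the test is the characteristic function
    of the negation. It is total, so the search never meets an undefined value.\<close>
  obtain f where f: "\<And>ys. length ys = Suc k \<Longrightarrow> recf_apply f ys = Some (of_bool (\<not> P ys))"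
    using decidable_not[OF assms] unfolding decidable_def total_recursive_def by blast
  have "recf_apply (Mu f) xs = Some v \<longleftrightarrow> P (v # xs) \<and> (\<forall>i<v. \<not> P (i # xs))"
    if "length xs = k" for xs v
    unfolding recf_apply_Mu_eq_Some_iff using that by (auto simp: f of_bool_def split: if_splits)
  then show thesis
    using that by blast
qed

lemma decidable_search_defined:
  assumes "\<And>v. recf_apply (Mu f) xs = Some v \<longleftrightarrow> P (v # xs) \<and> (\<forall>i<v. \<not> P (i # xs))"
    and "P (s # xs)"
  obtains v where "recf_apply (Mu f) xs = Some v" "P (v # xs)"
  using assms exists_least_iff[of "\<lambda>s. P (s # xs)"] by blast

text \<open>The relation is the domain of the search for a witness \<open>t\<close>, which halts
  whenever a witness exists.\<close>

lemma re_rel_Ex_decidable: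
  assumes "decidable 3 P"
  shows "re_rel {(x, y). \<exists>t. P [t, x, y]}"
proof -
  obtain f where f: "\<And>xs v. length xs = 2 \<Longrightarrow>
      recf_apply (Mu f) xs = Some v \<longleftrightarrow> P (v # xs) \<and> (\<forall>i<v. \<not> P (i # xs))"
    using decidable_search[of 2 P] assms by (auto simp: eval_nat_numeral)
  have "recf_apply (Mu f) [x, y] \<noteq> None \<longleftrightarrow> (\<exists>t. P [t, x, y])" for x y
    using f[of "[x, y]"] decidable_search_defined[of f "[x, y]" P]
    by (metis length_Cons list.size(3) not_Some_eq numeral_2_eq_2)
  then show ?thesis
    unfolding re_rel_def partial_recursive2_def
    by (intro exI[of _ "\<lambda>x y. recf_apply (Mu f) [x, y]"]) auto
qed

section \<open>Digit codes and enumeration of the reflexive transitive closure\<close>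

definition digit :: "nat \<Rightarrow> nat \<Rightarrow> nat \<Rightarrow> nat" where
  "digit b c i = c div b ^ i mod b"

lemma total_recursive_digit:
  assumes "total_recursive k B" "total_recursive k C" "total_recursive k N"
  shows "total_recursive k (\<lambda>xs. digit (B xs) (C xs) (N xs))"
  unfolding digit_def
  by (intro total_recursive_mod total_recursive_div total_recursive_power assms)

text \<open>Horner's scheme: the first entry becomes the lowest digit, and the code of the remaining
  entries is shifted up by one place.\<close>

lemma ex_digits:
  fixes b :: nat
  assumes "\<And>i. i < n \<Longrightarrow> f i < b"
  shows "\<exists>c. \<forall>i<n. digit b c i = f i"
  using assms
proof (induction n arbitrary: f)
  case 0
  show ?case
    by simp
next
  case (Suc n)
  obtain c where c: "\<And>i. i < n \<Longrightarrow> digit b c i = f (Suc i)"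
    using Suc.IH[of "\<lambda>i. f (Suc i)"] Suc.prems by auto
  have f0: "f 0 < b"
    using Suc.prems by simp
  have "digit b (f 0 + b * c) i = f i" if "i < Suc n" for i
  proof (cases i)
    case 0
    then show ?thesis
      using f0 by (simp add: digit_def)
  next
    case (Suc j)
    then show ?thesis
      using c[of j] f0 that by (simp add: digit_def div_mult2_eq)
  qed
  then show ?case
    by blast
qed

lemma ex_digits_code:
  fixes f :: "nat \<Rightarrow> nat"
  obtains b c where "\<And>i. i \<le> n \<Longrightarrow> digit b c i = f i"
proof -
  \<comment> \<open>A base exceeding the sum of all entries exceeds each of them.\<close>
  have "f i < Suc (\<Sum>j\<le>n. f j)" if "i < Suc n" for i
    using that by (intro le_imp_less_Suc member_le_sum) auto
  from ex_digits[of "Suc n" f, OF this] that show thesis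
    by (auto simp: less_Suc_eq_le)
qed

text \<open>A path is given by a base, a code and a length. One number \<open>t\<close> bounds all
  three and is also the stage at which each edge is confirmed. A single stage suffices because a
  path has finitely many edges and each of them is confirmed at all sufficiently late
  stages.\<close>

lemma re_rel_rtrancl:
  assumes F: "total_recursive 3 F"
    and R: "\<And>x y. (x, y) \<in> R \<longleftrightarrow> (\<exists>s. F [s, x, y] = Suc x)"
    and R_ev: "\<And>x y. (x, y) \<in> R \<Longrightarrow> \<forall>\<^sub>F s in sequentially. F [s, x, y] = Suc x"
  shows "re_rel (R\<^sup>*)"
proof -
  define P where "P = (\<lambda>xs::nat list.
    \<exists>b<xs ! 0. \<exists>c<xs ! 0. \<exists>n<xs ! 0. digit b c 0 = xs ! 1 \<and> digit b c n = xs ! 2 \<and>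
      (\<forall>i<n. F [xs ! 0, digit b c i, digit b c (Suc i)] = Suc (digit b c i)))"
  have "decidable 3 P"
    unfolding P_def
    by (intro decidable_Ex_less decidable_All_less decidable_conj decidable_eq
        total_recursive_digit total_recursive_Suc
        total_recursive_comp[OF F[unfolded numeral_3_eq_3]] total_recursive_list_Cons total_recursive_list_Nil
        total_recursive_nth total_recursive_nth_drop total_recursive_const
        | simp add: total_recursive_nth_drop)+
  moreover have "R\<^sup>* = {(x, y). \<exists>t. P [t, x, y]}"
  proof (intro subset_antisym subrelI)
    fix x y
    assume "(x, y) \<in> R\<^sup>*"
    then obtain n f where f: "f 0 = x" "f n = y" "\<And>i. i < n \<Longrightarrow> (f i, f (Suc i)) \<in> R"
      by (auto simp: rtrancl_power relpow_fun_conv)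
    obtain b c where bc: "\<And>i. i \<le> n \<Longrightarrow> digit b c i = f i"
      using ex_digits_code by blast
    have "\<forall>\<^sub>F s in sequentially. \<forall>i\<in>{..<n}. F [s, f i, f (Suc i)] = Suc (f i)"
      using f(3) R_ev by (intro eventually_ball_finite) auto
    then have "\<forall>\<^sub>F s in sequentially.
        (\<forall>i\<in>{..<n}. F [s, f i, f (Suc i)] = Suc (f i)) \<and> b < s \<and> c < s \<and> n < s"
      by (intro eventually_conj eventually_gt_at_top)
    then obtain t where t: "\<And>i. i < n \<Longrightarrow> F [t, f i, f (Suc i)] = Suc (f i)" "b < t" "c < t" "n < t"
      by (auto dest!: eventually_happens'[OF sequentially_bot])
    have "P [t, x, y]"
      unfolding P_def
      using t f(1,2)
      by (intro exI[of _ b] exI[of _ c] exI[of _ n] conjI) (simp_all add: bc)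
    then show "(x, y) \<in> {(x, y). \<exists>t. P [t, x, y]}"
      by blast
  next
    fix x y
    assume "(x, y) \<in> {(x, y). \<exists>t. P [t, x, y]}"
    then obtain t where "P [t, x, y]"
      by blast
    then obtain b c n where x: "digit b c 0 = x" and y: "digit b c n = y"
      and "\<And>i. i < n \<Longrightarrow>
        F [t, digit b c i, digit b c (Suc i)] = Suc (digit b c i)"
      unfolding P_def by auto
    then have "(digit b c i, digit b c (Suc i)) \<in> R" if "i < n" for i
      using R that by blast
    then have "(x, y) \<in> R ^^ n"
      unfolding relpow_fun_conv using x y by (intro exI[of _ "digit b c"]) blast
    then show "(x, y) \<in> R\<^sup>*"
      by (rule relpow_imp_rtrancl)
  qed
  ultimately show ?thesis
    using re_rel_Ex_decidable by simp
qed

section \<open>The two directions of the equivalence\<close>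

lemma weakly_semirecursive_imp_initial_segment:
  assumes "weakly_semirecursive M"
  shows "\<exists>r. preorder_on UNIV r \<and> re_rel r \<and> initial_segment M r"
proof -
  obtain \<psi> where \<psi>: "partial_recursive2 \<psi>"
    and sel: "\<And>x y. (x \<in> M) \<noteq> (y \<in> M) \<Longrightarrow> \<exists>z. \<psi> x y = Some z \<and> z \<in> {x, y} \<inter> M"
    using assms unfolding weakly_semirecursive_def by blast
  obtain F where F: "total_recursive 3 F"
    and sound: "\<And>s x y v. F [s, x, y] = Suc v \<Longrightarrow> \<psi> x y = Some v"
    and complete: "\<And>x y v. \<psi> x y = Some v \<Longrightarrow> \<forall>\<^sub>F s in sequentially. F [s, x, y] = Suc v"
    using partial_recursive2_stage_function[OF \<psi>] by blast
  \<comment> \<open>An edge records that the selector prefers its first argument. Reflexivity and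
    transitivity come from the closure.\<close>
  define R where "R = {(x, y). \<psi> x y = Some x}"
  have "re_rel (R\<^sup>*)"
  proof (rule re_rel_rtrancl[OF F])
    show "\<forall>\<^sub>F s in sequentially. F [s, x, y] = Suc x" if "(x, y) \<in> R" for x y
      using complete that unfolding R_def by blast
    then show "(x, y) \<in> R \<longleftrightarrow> (\<exists>s. F [s, x, y] = Suc x)" for x y
      using sound eventually_happens'[OF sequentially_bot] unfolding R_def by fastforce
  qed
  moreover have "initial_segment M (R\<^sup>*)"
    unfolding initial_segment_def
  proof (intro ballI conjI)
    fix x y
    assume x: "x \<in> M" and y: "y \<in> - M"
    have "(x, y) \<in> R"
      using sel[of x y] x y unfolding R_def by auto
    then show "(x, y) \<in> R\<^sup>*"
      by blast
    \<comment> \<open>The complement of \<open>M\<close> is closed under \<open>R\<close>: for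
      \<open>u\<close> outside and \<open>v\<close> inside \<open>M\<close> the selector returns
      \<open>v\<close>, which differs from \<open>u\<close>, so there is no edge from
      \<open>u\<close> to \<open>v\<close>.\<close>
    have "z \<notin> M" if "(y, z) \<in> R\<^sup>*" for z
      using that
    proof induction
      case base
      show ?case
        using y by simp
    next
      case (step u v)
      then show ?case
        using sel[of u v] unfolding R_def by auto
    qed
    then show "(y, x) \<notin> R\<^sup>*"
      using x by blast
  qed
  moreover have "preorder_on UNIV (R\<^sup>*)"
    by (simp add: preorder_on_def refl_rtrancl trans_rtrancl)
  ultimately show ?thesis
    by blast
qed

text \<open>If exactly one of \<open>x\<close> and \<open>y\<close> lies in \<open>M\<close>, then
  \<open>r\<close> relates them in exactly one direction, and the direction identifies the element
  of \<open>M\<close>. The selector searches for a stage at which one of the two comparisons shows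
  up.\<close>

lemma initial_segment_imp_weakly_semirecursive:
  assumes "re_rel r" and "initial_segment M r"
  shows "weakly_semirecursive M"
proof -
  obtain \<phi> where \<phi>: "partial_recursive2 \<phi>" and r: "r = {(x, y). \<phi> x y \<noteq> None}"
    using assms(1) unfolding re_rel_def by blast
  obtain F where F: "total_recursive 3 F"
    and sound: "\<And>s x y v. F [s, x, y] = Suc v \<Longrightarrow> \<phi> x y = Some v"
    and complete: "\<And>x y v. \<phi> x y = Some v \<Longrightarrow> \<forall>\<^sub>F s in sequentially. F [s, x, y] = Suc v"
    using partial_recursive2_stage_function[OF \<phi>] by blast
  have r_iff: "(x, y) \<in> r \<longleftrightarrow> (\<exists>s. F [s, x, y] \<noteq> 0)" for x y
  proof
    assume "(x, y) \<in> r"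
    then obtain v where "\<phi> x y = Some v"
      unfolding r by auto
    from eventually_happens'[OF sequentially_bot complete[OF this]] show "\<exists>s. F [s, x, y] \<noteq> 0"
      by (metis nat.distinct(1))
  next
    assume "\<exists>s. F [s, x, y] \<noteq> 0"
    then obtain s v where "F [s, x, y] = Suc v"
      using not0_implies_Suc by blast
    from sound[OF this] show "(x, y) \<in> r"
      unfolding r by simp
  qed
  define P where "P = (\<lambda>xs. F [xs ! 0, xs ! 1, xs ! 2] \<noteq> 0 \<or> F [xs ! 0, xs ! 2, xs ! 1] \<noteq> 0)"
  have "decidable 3 P"
    unfolding P_def
    by (intro decidable_disj decidable_not decidable_eq total_recursive_const
        total_recursive_comp[OF F[unfolded numeral_3_eq_3]] total_recursive_list_Cons
        total_recursive_list_Nil total_recursive_nth) simp_all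
  then obtain f where f: "\<And>xs v. length xs = 2 \<Longrightarrow>
      recf_apply (Mu f) xs = Some v \<longleftrightarrow> P (v # xs) \<and> (\<forall>i<v. \<not> P (i # xs))"
    using decidable_search[of 2 P] by (auto simp: eval_nat_numeral)
  \<comment> \<open>The arguments are the stage found by the search and the pair. If the first
    comparison does not show at that stage, then the second one does, so the second element is the
    one to return.\<close>
  have "total_recursive 3 (\<lambda>xs. if F [xs ! 0, xs ! 1, xs ! 2] = 0 then xs ! 2 else xs ! 1)"
    by (intro total_recursive_if_zero
        total_recursive_comp[OF F[unfolded numeral_3_eq_3]] total_recursive_list_Cons
        total_recursive_list_Nil total_recursive_nth) simp_all
  then obtain g where g: "\<And>xs. length xs = 3 \<Longrightarrow> recf_apply g xs =
      Some (if F [xs ! 0, xs ! 1, xs ! 2] = 0 then xs ! 2 else xs ! 1)"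
    unfolding total_recursive_def by blast
  define \<psi> where "\<psi> x y = recf_apply (Comp g [Mu f, Proj 0, Proj 1]) [x, y]" for x y
  have "\<exists>z. \<psi> x y = Some z \<and> z \<in> {x, y} \<inter> M" if xy: "(x \<in> M) \<noteq> (y \<in> M)" for x y
  proof -
    have "(x, y) \<in> r \<or> (y, x) \<in> r"
      using assms(2) xy unfolding initial_segment_def by blast
    then obtain s where "P (s # [x, y])"
      unfolding P_def r_iff by auto
    then obtain v where v: "recf_apply (Mu f) [x, y] = Some v" and P: "P [v, x, y]"
      using decidable_search_defined[of f "[x, y]" P s] f[of "[x, y]"] by auto
    have "\<psi> x y = recf_apply g [v, x, y]"
      unfolding \<psi>_def by (rule recf_apply_Comp) (use v in simp)
    then have \<psi>: "\<psi> x y = Some (if F [v, x, y] = 0 then y else x)"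
      by (simp add: g)
    show ?thesis
    proof (cases "F [v, x, y] = 0")
      case True
      then have "(y, x) \<in> r"
        using P unfolding P_def r_iff by auto
      \<comment> \<open>Were \<open>x\<close> the element of \<open>M\<close>, the pair
        \<open>(y, x)\<close> would not belong to \<open>r\<close>.\<close>
      then have "y \<in> M"
        using assms(2) xy unfolding initial_segment_def by blast
      then show ?thesis
        using \<psi> True by simp
    next
      case False
      then have "(x, y) \<in> r"
        unfolding r_iff by blast
      then have "x \<in> M"
        using assms(2) xy unfolding initial_segment_def by blast
      then show ?thesis
        using \<psi> False by simp
    qed
  qed
  moreover have "partial_recursive2 \<psi>"
    unfolding partial_recursive2_def \<psi>_def
    by (rule exI[of _ "Comp g [Mu f, Proj 0, Proj 1]"]) simp
  ultimately show ?thesis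
    unfolding weakly_semirecursive_def by blast
qed

theorem theorem4:
  fixes M :: "nat set"
  shows "weakly_semirecursive M \<longleftrightarrow>
    (\<exists>r :: nat rel. preorder_on UNIV r \<and> re_rel r \<and> initial_segment M r)"
  using weakly_semirecursive_imp_initial_segment initial_segment_imp_weakly_semirecursive
  by blast

end
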